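(* Let $i\ge0$ and let $K_1$ and $K_2$ be finite abstract simplicial complexes such that the spectra of $\Delta_i^{up}(K_1)$ and $\Delta_i^{up}(K_2)$ both contain the eigenvalue $\lambda$, with corresponding eigenfunctions $f_1$ and $f_2$. Suppose the $i$-wedge $K:=K_1\vee_iK_2$ is obtained by identifying $i$-faces $F_1\in S_i(K_1)$ and $F_2\in S_i(K_2)$ for which $f_1([F_1])=f_2([F_2])$, where the orientations $[F_1]$ and $[F_2]$ correspond to each other under the identification. Then the spectrum of $\Delta_i^{up}(K)$ contains the eigenvalue $\lambda$, too.
   Context: Given $i$-faces $F_1=\{v_0,\dots,v_i\}$ of $K_1$ and $F_2=\{u_0,\dots,u_i\}$ of $K_2$, the combinatorial $i$-wedge sum $K_1\vee_iK_2$ is the simplicial complex obtained from the disjoint union of $K_1$ and $K_2$ by identifying $v_j$ with $u_j$ for $j=0,\dots,i$ (so $F_1$ is identified with $F_2$); its faces are exactly the images of faces of $K_1$ and of $K_2$. For a finite abstract simplicial complex $K$ (closed under inclusion, containing the empty face), $S_i(K)$ is the set of $i$-faces and $C^i(K,\mathbb{R})$ is the space of real functions on oriented $i$-faces that change sign when the orientation is reversed. The coboundary $\delta_i:C^i\to C^{i+1}$ is $(\delta_i f)([v_0,\dots,v_{i+1}])=\sum_{j}(-1)^j f([v_0,\dots,\hat v_j,\dots,v_{i+1}])$. A positive weight function $w$ on faces defines inner products $(f,g)_{C^i}=\sum_{F\in S_i(K)}w(F)f([F])g([F])$, with adjoint $\delta_i^*$. The degree of an $i$-face is $\deg F=\sum_{\bar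 F\in S_{i+1}(K),\,F\subset\bar F}w(\bar F)$. The normalized combinatorial Laplacian is $\Delta_i^{up}(K)=\delta_i^*\delta_i$ on $C^i(K,\mathbb{R})$ for the weight function with $w(F)=1$ for every facet (inclusion-maximal face) and $w(F)=\deg F$ for every other face. *)

theory Defs
  imports Complex_Main "HOL-Combinatorics.Permutations"
begin

definition finite_complex :: "'a set set \<Rightarrow> bool" where
  "finite_complex K \<longleftrightarrow> finite K \<and> {} \<in> K \<and> (\<forall>F\<in>K. finite F) \<and> (\<forall>F\<in>K. \<forall>G. G \<subseteq> F \<longrightarrow> G \<in> K)"

definition faces :: "'a set set \<Rightarrow> nat \<Rightarrow> 'a set set" where
  "faces K i = {F \<in> K. card F = Suc i}"

definition facet :: "'a set set \<Rightarrow> 'a set \<Rightarrow> bool" where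
  "facet K F \<longleftrightarrow> F \<in> K \<and> (\<forall>G\<in>K. F \<subseteq> G \<longrightarrow> G = F)"

text \<open>Oriented faces: \<open>oriented [v0, \<dots>, vi]\<close> is the class of the ordering
  \<open>v0, \<dots>, vi\<close> modulo even permutations. A vertex has only one ordering, so for
  \<open>i = 0\<close> there is one oriented face per vertex and cochains are just functions on vertices.\<close>

definition ordered_faces :: "'a set set \<Rightarrow> nat \<Rightarrow> 'a list set" where
  "ordered_faces K i = {vs. distinct vs \<and> set vs \<in> faces K i}"

definition oriented :: "'a list \<Rightarrow> 'a list set" where
  "oriented vs = {permute_list p vs | p. p permutes {..<length vs} \<and> evenperm p}"

definition oriented_faces :: "'a set set \<Rightarrow> nat \<Rightarrow> 'a list set set" where
  "oriented_faces K i = oriented ` ordered_faces K i"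

text \<open>Cochains are extended by zero outside the oriented \<open>i\<close>-faces, so that equality of
  cochains is equality of functions.\<close>

definition cochains :: "'a set set \<Rightarrow> nat \<Rightarrow> ('a list set \<Rightarrow> real) set" where
  "cochains K i = {f.
     (\<forall>vs \<in> ordered_faces K i. \<forall>p. p permutes {..<length vs} \<and> \<not> evenperm p \<longrightarrow>
        f (oriented (permute_list p vs)) = - f (oriented vs)) \<and>
     (\<forall>c. c \<notin> oriented_faces K i \<longrightarrow> f c = 0)}"

text \<open>For a cochain \<open>f\<close> the alternating sum does not depend on the ordering chosen from the
  oriented face \<open>c\<close>.\<close>

definition coboundary ::
    "'a set set \<Rightarrow> nat \<Rightarrow> ('a list set \<Rightarrow> real) \<Rightarrow> ('a list set \<Rightarrow> real)" where
  "coboundary K i f c =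
     (if c \<in> oriented_faces K (Suc i)
      then let vs = (SOME vs. vs \<in> c) in
        (\<Sum>j\<le>Suc i. (-1) ^ j * f (oriented (take j vs @ drop (Suc j) vs)))
      else 0)"

text \<open>An arbitrary orientation of each face. The product \<open>f [F] * g [F]\<close> of two cochains does
  not depend on it.\<close>

definition some_orientation :: "'a set \<Rightarrow> 'a list set" where
  "some_orientation F = oriented (SOME vs. distinct vs \<and> set vs = F)"

definition cochain_inner :: "'a set set \<Rightarrow> ('a set \<Rightarrow> real) \<Rightarrow> nat \<Rightarrow>
    ('a list set \<Rightarrow> real) \<Rightarrow> ('a list set \<Rightarrow> real) \<Rightarrow> real" where
  "cochain_inner K w i f g =
     (\<Sum>F\<in>faces K i. w F * f (some_orientation F) * g (some_orientation F))"

definition coboundary_adjoint :: "'a set set \<Rightarrow> ('a set \<Rightarrow> real) \<Rightarrow> nat \<Rightarrow>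
    ('a list set \<Rightarrow> real) \<Rightarrow> ('a list set \<Rightarrow> real)" where
  "coboundary_adjoint K w i h = (THE g. g \<in> cochains K i \<and>
     (\<forall>f\<in>cochains K i.
        cochain_inner K w (Suc i) (coboundary K i f) h = cochain_inner K w i f g))"

definition up_laplacian :: "'a set set \<Rightarrow> ('a set \<Rightarrow> real) \<Rightarrow> nat \<Rightarrow>
    ('a list set \<Rightarrow> real) \<Rightarrow> ('a list set \<Rightarrow> real)" where
  "up_laplacian K w i f = coboundary_adjoint K w i (coboundary K i f)"

definition degree :: "'a set set \<Rightarrow> ('a set \<Rightarrow> real) \<Rightarrow> 'a set \<Rightarrow> real" where
  "degree K w F = (\<Sum>G | G \<in> K \<and> card G = Suc (card F) \<and> F \<subset> G. w G)"

text \<open>The defining equations of the normalized weight are a recursion from the facets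
  downwards, with \<open>degree\<close> unfolded; see \<open>normalized_weight_facet\<close> and
  \<open>normalized_weight_nonfacet\<close> below. The value off the complex is irrelevant.\<close>

function normalized_weight :: "'a set set \<Rightarrow> 'a set \<Rightarrow> real" where
  "normalized_weight K F =
     (if \<not> finite_complex K \<or> F \<notin> K then 0
      else if facet K F then 1
      else (\<Sum>G | G \<in> K \<and> card G = Suc (card F) \<and> F \<subset> G. normalized_weight K G))"
  by pat_completeness auto
termination
proof (relation "measure (\<lambda>(K, F). card (\<Union>K) - card F)", goal_cases)
  case 1
  show ?case by simp
next
  case (2 K F G)
  then have "finite (\<Union>K)" "G \<subseteq> \<Union>K"
    by (auto simp: finite_complex_def)
  then have "card G \<le> card (\<Union>K)"
    by (rule card_mono)
  with 2 show ?case by auto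
qed

declare normalized_weight.simps [simp del]

lemma normalized_weight_facet:
  "finite_complex K \<Longrightarrow> facet K F \<Longrightarrow> normalized_weight K F = 1"
  by (subst normalized_weight.simps) (simp add: facet_def)

lemma normalized_weight_nonfacet:
  "finite_complex K \<Longrightarrow> F \<in> K \<Longrightarrow> \<not> facet K F \<Longrightarrow>
     normalized_weight K F = degree K (normalized_weight K) F"
  by (subst normalized_weight.simps) (simp add: degree_def)

definition normalized_up_laplacian :: "'a set set \<Rightarrow> nat \<Rightarrow>
    ('a list set \<Rightarrow> real) \<Rightarrow> ('a list set \<Rightarrow> real)" where
  "normalized_up_laplacian K i = up_laplacian K (normalized_weight K) i"

definition eigenfunction :: "'a set set \<Rightarrow> nat \<Rightarrow> real \<Rightarrow> ('a list set \<Rightarrow> real) \<Rightarrow> bool" where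
  "eigenfunction K i lam f \<longleftrightarrow> f \<in> cochains K i \<and> f \<noteq> (\<lambda>_. 0) \<and>
     normalized_up_laplacian K i f = (\<lambda>c. lam * f c)"

text \<open>The operator is self-adjoint, so restricting to real eigenvalues loses nothing.\<close>

definition up_spectrum :: "'a set set \<Rightarrow> nat \<Rightarrow> real set" where
  "up_spectrum K i = {lam. \<exists>f. eigenfunction K i lam f}"

text \<open>The wedge sum of \<open>K1\<close> and \<open>K2\<close> along \<open>vs = [v0, \<dots>, vi]\<close> and \<open>us = [u0, \<dots>, ui]\<close>. Its
  vertices are the classes of the disjoint union of the vertices modulo \<open>vj ~ uj\<close>. The
  relation is an equivalence when \<open>vs\<close> and \<open>us\<close> are distinct lists of the same length.\<close>

definition wedge_rel :: "'a list \<Rightarrow> 'b list \<Rightarrow> (('a + 'b) \<times> ('a + 'b)) set" where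
  "wedge_rel vs us = Id \<union> {(Inl v, Inr u) | v u. (v, u) \<in> set (zip vs us)}
                        \<union> {(Inr u, Inl v) | v u. (v, u) \<in> set (zip vs us)}"

definition wedge_sum ::
    "'a list \<Rightarrow> 'b list \<Rightarrow> 'a set set \<Rightarrow> 'b set set \<Rightarrow> ('a + 'b) set set set" where
  "wedge_sum vs us K1 K2 =
     (\<lambda>F. (\<lambda>v. wedge_rel vs us `` {Inl v}) ` F) ` K1 \<union>
     (\<lambda>F. (\<lambda>u. wedge_rel vs us `` {Inr u}) ` F) ` K2"

lemma equiv_wedge_rel:
  assumes "distinct vs" "distinct us" "length vs = length us"
  shows "equiv UNIV (wedge_rel vs us)"
proof (rule equivI)
  have "v = v'" if "(v, u) \<in> set (zip vs us)" "(v', u) \<in> set (zip vs us)" for v v' u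
    using that assms by (auto simp: in_set_zip nth_eq_iff_index_eq)
  moreover have "u = u'" if "(v, u) \<in> set (zip vs us)" "(v, u') \<in> set (zip vs us)" for v u u'
    using that assms by (auto simp: in_set_zip nth_eq_iff_index_eq)
  ultimately show "trans (wedge_rel vs us)"
    unfolding trans_def wedge_rel_def by blast
qed (auto simp: wedge_rel_def refl_on_def sym_def)

end

theory Submission
  imports Defs
begin

text \<open>
  In weak form, \<open>f\<close> is an eigenfunction iff \<open>(\<delta>g, \<delta>f) = \<lambda>(g, f)\<close> for all cochains \<open>g\<close>. Since
  \<open>f1\<close> and \<open>f2\<close> agree on the glued face \<open>F\<close>, they are the restrictions of one cochain \<open>f\<close> on
  the wedge. The \<open>(i+1)\<close>-faces of the wedge are those of \<open>K1\<close> and those of \<open>K2\<close>, without overlap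
  and with the same weights, so \<open>(\<delta>g, \<delta>f)\<close> is the sum of its two restrictions, and hence
  \<open>\<lambda>\<close> times the sum of the inner products of the restrictions of \<open>g\<close> and \<open>f\<close>. This sum differs
  from \<open>(g, f)\<close> only in the weight of \<open>F\<close>: it has \<open>w1(F) + w2(F)\<close> in place of \<open>w(F)\<close>. The two
  agree if \<open>F\<close> is a facet of neither complex. If \<open>F\<close> is a facet of \<open>K1\<close> or \<open>K2\<close>, they need not
  agree, but then \<open>\<lambda>f(F) = 0\<close>, because the Laplacian of that complex vanishes on \<open>F\<close>.
\<close>

subsection \<open>Alternating functions on lists\<close>

text \<open>Stated through adjacent swaps of arbitrary lists, so that closure properties follow by
  list manipulation. Adjacent transpositions generate the symmetric group, so the sign rule for all
  permutations follows.\<close>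

definition alternating :: "('a list \<Rightarrow> real) \<Rightarrow> bool" where
  "alternating \<phi> \<longleftrightarrow> (\<forall>xs a b ys. \<phi> (xs @ b # a # ys) = - \<phi> (xs @ a # b # ys))"

lemma alternatingI:
  "(\<And>xs a b ys. \<phi> (xs @ b # a # ys) = - \<phi> (xs @ a # b # ys)) \<Longrightarrow> alternating \<phi>"
  unfolding alternating_def by iprover

lemma alternatingD: "alternating \<phi> \<Longrightarrow> \<phi> (xs @ b # a # ys) = - \<phi> (xs @ a # b # ys)"
  unfolding alternating_def by iprover

lemma permute_list_adjacent_transpose:
  assumes "Suc k < length vs"
  shows "permute_list (transpose k (Suc k)) vs =
    take k vs @ vs ! Suc k # vs ! k # drop (Suc (Suc k)) vs"
  using assms
  by (intro nth_equalityI)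
     (auto simp: permute_list_def transpose_def nth_append nth_Cons' not_less less_Suc_eq
        intro!: arg_cong[of _ _ "nth vs"])

lemma alternating_permute_list_adjacent:
  assumes "alternating \<phi>" "Suc k < length vs"
  shows "\<phi> (permute_list (transpose k (Suc k)) vs) = - \<phi> vs"
proof -
  have "take k vs @ vs ! k # vs ! Suc k # drop (Suc (Suc k)) vs = vs"
    using assms(2) by (simp add: Cons_nth_drop_Suc)
  moreover have "\<phi> (permute_list (transpose k (Suc k)) vs) =
      - \<phi> (take k vs @ vs ! k # vs ! Suc k # drop (Suc (Suc k)) vs)"
    unfolding permute_list_adjacent_transpose[OF assms(2)] by (rule alternatingD[OF assms(1)])
  ultimately show ?thesis by simp
qed

text \<open>By induction on the distance \<open>b - a\<close>: conjugating with an adjacent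
  transposition shortens it by one.\<close>

lemma alternating_permute_list_transpose:
  assumes "alternating \<phi>" "a < b" "b < length vs"
  shows "\<phi> (permute_list (transpose a b) vs) = - \<phi> vs"
  using assms(2,3)
proof (induction "b - a" arbitrary: b vs rule: less_induct)
  case less
  show ?case
  proof (cases "b = Suc a")
    case True
    then show ?thesis
      using assms(1) less.prems by (simp add: alternating_permute_list_adjacent)
  next
    case False
    then obtain c where c: "b = Suc c" "a < c"
      using less.prems by (cases b) auto
    have adj: "\<phi> (permute_list (transpose c b) ws) = - \<phi> ws" if "length ws = length vs" for ws
      using assms(1) less.prems c that by (simp add: alternating_permute_list_adjacent)
    have IH: "\<phi> (permute_list (transpose a c) ws) = - \<phi> ws" if "length ws = length vs" for ws
    proof (rule less.hyps)
      show "c - a < b - a" "a < c" "c < length ws"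
        using c less.prems that by linarith+
    qed
    have perm: "transpose c b permutes {..<length vs}" "transpose a c permutes {..<length vs}"
      using less.prems c by (auto intro!: permutes_swap_id)
    \<comment> \<open>Three factors, hence three sign changes, which amount to one.\<close>
    have tr: "transpose a b = transpose c b \<circ> transpose a c \<circ> transpose c b"
      using c by (auto simp: fun_eq_iff transpose_def)
    have "permute_list (transpose a b) vs =
        permute_list (transpose c b) (permute_list (transpose c b \<circ> transpose a c) vs)"
      unfolding tr by (rule permute_list_compose) (rule perm)
    also have "permute_list (transpose c b \<circ> transpose a c) vs =
        permute_list (transpose a c) (permute_list (transpose c b) vs)"
      by (rule permute_list_compose) (rule perm)
    finally show ?thesis
      by (simp add: adj IH)
  qed
qed

lemma alternating_permute_list:
  assumes "alternating \<phi>" "p permutes {..<length vs}"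
  shows "\<phi> (permute_list p vs) = of_int (sign p) * \<phi> vs"
proof -
  \<comment> \<open>The new transposition acts on the list before \<open>p\<close> does, so the
    induction hypothesis is needed at a permuted list; hence the quantifier over
    \<open>vs\<close>.\<close>
  have "\<forall>vs. length vs = n \<longrightarrow> \<phi> (permute_list p vs) = of_int (sign p) * \<phi> vs"
    if "p permutes {..<n}" for n
    using that finite_lessThan[of n]
  proof (induction rule: permutes_induct)
    case id
    then show ?case by simp
  next
    case (swap a b p)
    have perm: "permutation p"
      using swap.hyps by (metis finite_lessThan permutation_permutes)
    have tr: "\<phi> (permute_list (transpose a b) vs) = of_int (sign (transpose a b)) * \<phi> vs"
      if "length vs = n" for vs
    proof (cases a b rule: linorder_cases)
      case less
      then show ?thesis
        using alternating_permute_list_transpose[OF assms(1), of a b vs] swap.hyps that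
        by (simp add: sign_swap_id)
    next
      case equal
      then show ?thesis by simp
    next
      case greater
      then show ?thesis
        using alternating_permute_list_transpose[OF assms(1), of b a vs] swap.hyps that
        by (simp add: sign_swap_id transpose_commute)
    qed
    show ?case
    proof (intro allI impI)
      fix vs :: "'a list"
      assume len: "length vs = n"
      have "permute_list (transpose a b \<circ> p) vs = permute_list p (permute_list (transpose a b) vs)"
        by (rule permute_list_compose) (use swap.hyps len in simp)
      moreover have "sign (transpose a b \<circ> p) = sign (transpose a b) * sign p"
        using perm by (intro sign_compose permutation_swap_id)
      ultimately show "\<phi> (permute_list (transpose a b \<circ> p) vs) =
          of_int (sign (transpose a b \<circ> p)) * \<phi> vs"
        using tr[OF len] swap.IH[rule_format, of "permute_list (transpose a b) vs"] len
        by (simp add: mult.assoc mult.left_commute del: o_apply)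
    qed
  qed
  from this[OF assms(2), rule_format, OF refl] show ?thesis .
qed

lemma alternating_cmult:
  assumes "alternating \<phi>"
  shows "alternating (\<lambda>l. k * \<phi> l)"
proof (rule alternatingI)
  show "k * \<phi> (xs @ b # a # ys) = - (k * \<phi> (xs @ a # b # ys))" for xs a b ys
    unfolding alternatingD[OF assms, of xs b a ys] by (rule mult_minus_right)
qed

lemma alternating_map:
  assumes "alternating \<phi>"
  shows "alternating (\<lambda>l. \<phi> (map h l))"
proof (rule alternatingI)
  show "\<phi> (map h (xs @ b # a # ys)) = - \<phi> (map h (xs @ a # b # ys))" for xs a b ys
    using alternatingD[OF assms, of "map h xs" "h b" "h a" "map h ys"] by simp
qed

lemma alternating_Cons:
  assumes "alternating \<phi>"
  shows "alternating (\<lambda>l. \<phi> (x # l))"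
proof (rule alternatingI)
  show "\<phi> (x # xs @ b # a # ys) = - \<phi> (x # xs @ a # b # ys)" for xs a b ys
    using alternatingD[OF assms, of "x # xs" b a ys] by simp
qed

text \<open>A swap leaves the vertex set unchanged, so it never switches branches. This serves both
  to cut a function down to one face and to merge functions from two complexes.\<close>

lemma alternating_if_set:
  assumes "alternating \<phi>" "alternating \<psi>"
  shows "alternating (\<lambda>l. if P (set l) then \<phi> l else \<psi> l)"
proof (rule alternatingI)
  fix xs ys :: "'a list" and a b
  have "set (xs @ b # a # ys) = set (xs @ a # b # ys)" by auto
  then show "(if P (set (xs @ b # a # ys)) then \<phi> (xs @ b # a # ys) else \<psi> (xs @ b # a # ys)) =
      - (if P (set (xs @ a # b # ys)) then \<phi> (xs @ a # b # ys) else \<psi> (xs @ a # b # ys))"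
    using alternatingD[OF assms(1), of xs b a ys] alternatingD[OF assms(2), of xs b a ys]
    by presburger
qed

lemma alternating_zero: "alternating (\<lambda>_. 0)"
  by (simp add: alternating_def)

lemma permutes_of_same_set:
  assumes "distinct vs" "distinct ws" "set vs = set ws"
  obtains p where "p permutes {..<length vs}" "ws = permute_list p vs"
  using assms mset_eq_permutation[of ws vs] set_eq_iff_mset_eq_distinct[of ws vs] by auto

text \<open>Both factors change by the same sign, whose square is 1.\<close>

lemma alternating_prod_eq:
  assumes "alternating \<phi>" "alternating \<psi>" "distinct vs" "distinct ws" "set vs = set ws"
  shows "\<phi> vs * \<psi> vs = \<phi> ws * \<psi> ws"
proof -
  obtain p where p: "p permutes {..<length vs}" "ws = permute_list p vs"
    using permutes_of_same_set assms by blast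
  show ?thesis
    using alternating_permute_list[OF assms(1) p(1)] alternating_permute_list[OF assms(2) p(1)]
    by (simp add: p(2) sign_def)
qed

text \<open>On the orderings of one vertex set an alternating function is determined by a single
  value.\<close>

lemma alternating_eqI:
  assumes "alternating \<phi>" "alternating \<psi>" "distinct vs" "distinct ws" "set vs = set ws"
    and "\<phi> vs = \<psi> vs"
  shows "\<phi> ws = \<psi> ws"
proof -
  obtain p where p: "p permutes {..<length vs}" "ws = permute_list p vs"
    using permutes_of_same_set assms by blast
  show ?thesis
    using alternating_permute_list[OF assms(1) p(1)] alternating_permute_list[OF assms(2) p(1)] assms(6)
    by (simp add: p(2))
qed

section \<open>The alternating sum over vertex deletions\<close>

fun boundary_sum :: "('a list \<Rightarrow> real) \<Rightarrow> 'a list \<Rightarrow> real" where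
  "boundary_sum \<phi> [] = 0"
| "boundary_sum \<phi> (a # l) = \<phi> l - boundary_sum (\<lambda>m. \<phi> (a # m)) l"

text \<open>Links the recursion, which suits induction over list prefixes, to the indexed sum in
  \<open>coboundary\<close>.\<close>

lemma boundary_sum_conv_sum:
  "boundary_sum \<phi> vs = (\<Sum>j<length vs. (-1) ^ j * \<phi> (take j vs @ drop (Suc j) vs))"
proof (induction vs arbitrary: \<phi>)
  case (Cons a vs)
  show ?case
    by (simp add: Cons.IH sum.lessThan_Suc_shift sum_negf del: sum.lessThan_Suc)
qed simp

lemma boundary_sum_uminus: "boundary_sum (\<lambda>l. - \<phi> l) vs = - boundary_sum \<phi> vs"
  by (induction vs arbitrary: \<phi>) auto

text \<open>Induction on the prefix, absorbing its first vertex into \<open>\<phi>\<close>. In the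
  base case the deletions of \<open>a\<close> and of \<open>b\<close> trade places with opposite
  signs, and every other term contains both vertices and changes sign.\<close>

lemma alternating_boundary_sum:
  assumes "alternating \<phi>"
  shows "alternating (boundary_sum \<phi>)"
proof -
  have "boundary_sum \<phi> (xs @ b # a # ys) = - boundary_sum \<phi> (xs @ a # b # ys)"
    if "alternating \<phi>" for \<phi> :: "'a list \<Rightarrow> real" and xs ys a b
    using that
  proof (induction xs arbitrary: \<phi>)
    case Nil
    have "boundary_sum (\<lambda>l. \<phi> (b # a # l)) ys = boundary_sum (\<lambda>l. - \<phi> (a # b # l)) ys"
      using alternatingD[OF Nil, of "[]" b a] by simp
    then show ?case
      by (simp add: boundary_sum_uminus)
  next
    case (Cons x xs)
    then show ?case
      using Cons.IH[OF alternating_Cons[OF Cons.prems], of x] alternatingD[OF Cons.prems, of xs b a ys]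
      by simp
  qed
  from this[OF assms] show ?thesis
    by (rule alternatingI)
qed

text \<open>Plays the role of the sign of an ordering: it is alternating, and nonzero on the orderings of
  a set on which \<open>h\<close> is injective. This gives the cochain supported on a single face.\<close>

fun vandermonde :: "('a \<Rightarrow> real) \<Rightarrow> 'a list \<Rightarrow> real" where
  "vandermonde h [] = 1"
| "vandermonde h (a # l) = prod_list (map (\<lambda>b. h b - h a) l) * vandermonde h l"

text \<open>The swap reverses the one factor that compares \<open>a\<close> with \<open>b\<close>
  and only permutes the others.\<close>

lemma alternating_vandermonde: "alternating (vandermonde h)"
proof (rule alternatingI)
  fix xs ys :: "'a list" and a b
  show "vandermonde h (xs @ b # a # ys) = - vandermonde h (xs @ a # b # ys)"
  proof (induction xs)
    case Nil
    have "h a - h b = - (h b - h a)" by simp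
    then show ?case by (simp only: append_Nil vandermonde.simps list.map prod_list.Cons mult_ac
      mult_minus_left mult_minus_right)
  next
    case (Cons x xs)
    then show ?case by (simp add: mult_ac)
  qed
qed

lemma vandermonde_eq_0_iff:
  "inj_on h (set vs) \<Longrightarrow> vandermonde h vs = 0 \<longleftrightarrow> \<not> distinct vs"
  by (induction vs) (auto simp: prod_list_zero_iff inj_on_def)

subsection \<open>Cochains\<close>

lemma mem_oriented: "vs \<in> oriented vs"
  unfolding oriented_def
  by (rule CollectI, rule exI[of _ id]) simp

lemma mem_orientedD:
  assumes "ws \<in> oriented vs"
  shows "length ws = length vs" "set ws = set vs" "distinct ws \<longleftrightarrow> distinct vs"
  using assms by (auto simp: oriented_def)

lemma oriented_map: "oriented (map h vs) = map h ` oriented vs"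
proof (intro equalityI subsetI)
  fix ws
  assume "ws \<in> oriented (map h vs)"
  then show "ws \<in> map h ` oriented vs"
    by (auto simp: oriented_def permute_list_map)
next
  fix ws
  assume "ws \<in> map h ` oriented vs"
  then obtain p where "p permutes {..<length vs}" "evenperm p" "ws = map h (permute_list p vs)"
    by (auto simp: oriented_def)
  then show "ws \<in> oriented (map h vs)"
    by (auto simp: oriented_def permute_list_map[symmetric])
qed

lemma oriented_mem_oriented_faces_iff:
  "oriented vs \<in> oriented_faces K i \<longleftrightarrow> vs \<in> ordered_faces K i"
proof
  assume "oriented vs \<in> oriented_faces K i"
  then obtain ws where "ws \<in> ordered_faces K i" "vs \<in> oriented ws"
    using mem_oriented[of vs] by (auto simp: oriented_faces_def)
  then show "vs \<in> ordered_faces K i"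
    using mem_orientedD[of vs ws] by (auto simp: ordered_faces_def)
qed (simp add: oriented_faces_def)

lemma alternating_mem_oriented:
  "alternating \<phi> \<Longrightarrow> ws \<in> oriented vs \<Longrightarrow> \<phi> ws = \<phi> vs"
  using alternating_permute_list[of \<phi> _ vs] by (auto simp: oriented_def sign_def)

lemma ordered_faces_swap:
  "xs @ b # a # ys \<in> ordered_faces K i \<longleftrightarrow> xs @ a # b # ys \<in> ordered_faces K i"
  by (auto simp: ordered_faces_def insert_commute)

text \<open>An adjacent transposition is odd, which gives one direction; the sign rule for
  alternating functions gives the other.\<close>

lemma cochains_iff:
  "f \<in> cochains K i \<longleftrightarrow>
     alternating (\<lambda>l. f (oriented l)) \<and> (\<forall>c. c \<notin> oriented_faces K i \<longrightarrow> f c = 0)"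
proof (intro iffI conjI)
  assume f: "f \<in> cochains K i"
  show "\<forall>c. c \<notin> oriented_faces K i \<longrightarrow> f c = 0"
    using f by (simp add: cochains_def)
  show "alternating (\<lambda>l. f (oriented l))"
  proof (rule alternatingI)
    fix xs ys :: "'a list" and a b
    let ?v = "xs @ a # b # ys" and ?w = "xs @ b # a # ys" and ?k = "length xs"
    show "f (oriented ?w) = - f (oriented ?v)"
    proof (cases "?v \<in> ordered_faces K i")
      case True
      have "?w = permute_list (transpose ?k (Suc ?k)) ?v"
        by (subst permute_list_adjacent_transpose) (auto simp: nth_append)
      moreover have "transpose ?k (Suc ?k) permutes {..<length ?v}"
        by (auto intro!: permutes_swap_id)
      moreover have "\<not> evenperm (transpose ?k (Suc ?k))"
        by (simp add: evenperm_swap)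
      ultimately show ?thesis
        using f True unfolding cochains_def by auto
    next
      \<comment> \<open>Neither list is an ordered face, so the cochain vanishes on both, and the
        sign rule extends to arbitrary lists.\<close>
      case False
      then have "?w \<notin> ordered_faces K i"
        by (simp add: ordered_faces_swap)
      with False show ?thesis
        using f by (simp add: cochains_def oriented_mem_oriented_faces_iff)
    qed
  qed
next
  assume "alternating (\<lambda>l. f (oriented l)) \<and> (\<forall>c. c \<notin> oriented_faces K i \<longrightarrow> f c = 0)"
  then show "f \<in> cochains K i"
    using alternating_permute_list[of "\<lambda>l. f (oriented l)"]
    by (auto simp: cochains_def sign_def)
qed

text \<open>Turns an alternating function into a cochain. The choice of a representative is
  harmless, because even permutations preserve the value of such a function.\<close>

definition cochain_of :: "'a set set \<Rightarrow> nat \<Rightarrow> ('a list \<Rightarrow> real) \<Rightarrow> 'a list set \<Rightarrow> real" where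
  "cochain_of K i \<phi> c = (if c \<in> oriented_faces K i then \<phi> (SOME vs. vs \<in> c) else 0)"

lemma cochain_of_oriented:
  assumes "alternating \<phi>"
  shows "cochain_of K i \<phi> (oriented vs) = (if vs \<in> ordered_faces K i then \<phi> vs else 0)"
  using alternating_mem_oriented[OF assms someI[of "\<lambda>ws. ws \<in> oriented vs", OF mem_oriented]]
  by (simp add: cochain_of_def oriented_mem_oriented_faces_iff)

lemma alternating_if_ordered_faces:
  assumes "alternating \<phi>"
  shows "alternating (\<lambda>l. if l \<in> ordered_faces K i then \<phi> l else 0)"
proof (rule alternatingI)
  fix xs ys :: "'a list" and a b
  show "(if xs @ b # a # ys \<in> ordered_faces K i then \<phi> (xs @ b # a # ys) else 0) =
      - (if xs @ a # b # ys \<in> ordered_faces K i then \<phi> (xs @ a # b # ys) else 0)"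
    using alternatingD[OF assms, of xs b a ys] ordered_faces_swap[of xs b a ys] by auto
qed

lemma cochain_of_in_cochains: "alternating \<phi> \<Longrightarrow> cochain_of K i \<phi> \<in> cochains K i"
  unfolding cochains_iff
  by (simp add: cochain_of_oriented alternating_if_ordered_faces) (simp add: cochain_of_def)

lemma cochains_alternating: "f \<in> cochains K i \<Longrightarrow> alternating (\<lambda>l. f (oriented l))"
  by (simp add: cochains_iff)

lemma cochains_eqI:
  assumes "f \<in> cochains K i" "g \<in> cochains K i"
    and "\<And>vs. vs \<in> ordered_faces K i \<Longrightarrow> f (oriented vs) = g (oriented vs)"
  shows "f = g"
proof
  fix c
  show "f c = g c"
    using assms by (cases "c \<in> oriented_faces K i") (auto simp: cochains_iff oriented_faces_def)
qed

text \<open>Every representative of an oriented \<open>(i+1)\<close>-face has \<open>i + 2\<close>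
  entries, so the sum in \<open>coboundary\<close> runs over exactly its deletions.\<close>

lemma coboundary_eq_cochain_of:
  "coboundary K i f = cochain_of K (Suc i) (boundary_sum (\<lambda>l. f (oriented l)))"
proof
  fix c
  have "length vs = Suc (Suc i)" if "c = oriented ws" "ws \<in> ordered_faces K (Suc i)" "vs \<in> c" for vs ws
    using that mem_orientedD(1)[of vs ws]
    by (auto simp: ordered_faces_def faces_def distinct_card[symmetric])
  then have "length (SOME vs. vs \<in> c) = Suc (Suc i)" if "c \<in> oriented_faces K (Suc i)"
    using that someI[of "\<lambda>vs. vs \<in> c"] mem_oriented by (auto simp: oriented_faces_def)
  then show "coboundary K i f c = cochain_of K (Suc i) (boundary_sum (\<lambda>l. f (oriented l))) c"
    by (simp add: coboundary_def cochain_of_def boundary_sum_conv_sum Let_def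
        lessThan_Suc_atMost[symmetric] del: sum.lessThan_Suc)
qed

lemma coboundary_in_cochains: "f \<in> cochains K i \<Longrightarrow> coboundary K i f \<in> cochains K (Suc i)"
  unfolding coboundary_eq_cochain_of
  by (intro cochain_of_in_cochains alternating_boundary_sum cochains_alternating)

lemma coboundary_oriented:
  assumes "f \<in> cochains K i" "vs \<in> ordered_faces K (Suc i)"
  shows "coboundary K i f (oriented vs) = boundary_sum (\<lambda>l. f (oriented l)) vs"
  unfolding coboundary_eq_cochain_of
  using assms by (simp add: cochain_of_oriented alternating_boundary_sum cochains_alternating)

subsection \<open>The weak form of the eigenvalue equation\<close>

text \<open>Linearity in the form needed to expand a cochain in a basis.\<close>

lemma coboundary_lincomb:
  "coboundary K i (\<lambda>c. \<Sum>x\<in>A. a x * g x c) = (\<lambda>c. \<Sum>x\<in>A. a x * coboundary K i (g x) c)"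
proof
  fix c
  have "(\<Sum>j\<le>Suc i. (-1) ^ j * (\<Sum>x\<in>A. a x * g x (oriented (take j vs @ drop (Suc j) vs)))) =
      (\<Sum>x\<in>A. a x * (\<Sum>j\<le>Suc i. (-1) ^ j * g x (oriented (take j vs @ drop (Suc j) vs))))" for vs
    unfolding sum_distrib_left by (subst sum.swap) (simp only: mult.left_commute)
  then show "coboundary K i (\<lambda>c. \<Sum>x\<in>A. a x * g x c) c = (\<Sum>x\<in>A. a x * coboundary K i (g x) c)"
    unfolding coboundary_def Let_def by simp
qed

lemma cochains_lincomb:
  assumes "\<And>x. x \<in> A \<Longrightarrow> g x \<in> cochains K i"
  shows "(\<lambda>c. \<Sum>x\<in>A. a x * g x c) \<in> cochains K i"
  unfolding cochains_iff
proof
  show "alternating (\<lambda>l. \<Sum>x\<in>A. a x * g x (oriented l))"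
  proof (rule alternatingI)
    fix xs ys :: "'b list" and b c
    have "(\<Sum>x\<in>A. a x * g x (oriented (xs @ c # b # ys))) =
        (\<Sum>x\<in>A. - (a x * g x (oriented (xs @ b # c # ys))))"
      by (rule sum.cong[OF refl])
         (simp only: alternatingD[OF cochains_alternating[OF assms], of _ xs c b ys] mult_minus_right)
    then show "(\<Sum>x\<in>A. a x * g x (oriented (xs @ c # b # ys))) =
        - (\<Sum>x\<in>A. a x * g x (oriented (xs @ b # c # ys)))"
      by (simp only: sum_negf)
  qed
  show "\<forall>c. c \<notin> oriented_faces K i \<longrightarrow> (\<Sum>x\<in>A. a x * g x c) = 0"
    using assms by (simp add: cochains_iff)
qed

lemma cochains_cmult:
  assumes "f \<in> cochains K i"
  shows "(\<lambda>c. k * f c) \<in> cochains K i"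
  using cochains_lincomb[of "{()}" "\<lambda>_. f" K i "\<lambda>_. k"] assms by simp

lemma cochains_diff:
  assumes "f \<in> cochains K i" "g \<in> cochains K i"
  shows "(\<lambda>c. f c - g c) \<in> cochains K i"
  using cochains_lincomb[of UNIV "\<lambda>b. if b then f else g" K i "\<lambda>b. if b then 1 else -1"] assms
  by (simp add: UNIV_bool)

lemma some_orientationE:
  assumes "finite F"
  obtains vs where "distinct vs" "set vs = F" "some_orientation F = oriented vs"
  using someI_ex[OF finite_distinct_list[OF assms, unfolded conj_commute[of "set _ = F"]]]
  unfolding some_orientation_def by blast

text \<open>Exchanges the unspecified orientation for any given ordering. Single values cannot be
  exchanged this way, as the two may differ by a sign.\<close>

lemma some_orientation_prod:
  assumes "f \<in> cochains K i" "g \<in> cochains K i" "distinct vs"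
  shows "f (some_orientation (set vs)) * g (some_orientation (set vs)) =
    f (oriented vs) * g (oriented vs)"
proof -
  obtain ws where ws: "distinct ws" "set ws = set vs" "some_orientation (set vs) = oriented ws"
    by (rule some_orientationE[OF finite_set])
  show ?thesis
    unfolding ws(3)
    by (rule alternating_prod_eq) (use assms ws cochains_alternating in auto)
qed

lemma finite_complex_facesD:
  "finite_complex K \<Longrightarrow> finite (faces K i)"
  "finite_complex K \<Longrightarrow> F \<in> faces K i \<Longrightarrow> finite F"
  by (auto simp: finite_complex_def faces_def)

text \<open>The Vandermonde product of an injective numbering of \<open>F\<close> is cut off outside
  \<open>F\<close> and rescaled to have value 1 on the chosen orientation.\<close>

lemma ex_cochain_supported_on:
  assumes "F \<in> faces K i" "finite F"
  obtains e where "e \<in> cochains K i" "e (some_orientation F) = 1"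
    "\<And>vs. set vs \<noteq> F \<Longrightarrow> e (oriented vs) = 0"
proof -
  obtain vs where vs: "distinct vs" "set vs = F" "some_orientation F = oriented vs"
    using some_orientationE[OF assms(2)] by blast
  obtain h :: "_ \<Rightarrow> nat" where "inj_on h F"
    using finite_imp_inj_to_nat_seg[OF assms(2)] by blast
  define \<phi> where "\<phi> = (\<lambda>l. if set l = F then vandermonde (real \<circ> h) l else 0)"
  have alt: "alternating (\<lambda>l. inverse (\<phi> vs) * \<phi> l)"
    unfolding \<phi>_def
    by (intro alternating_cmult alternating_if_set alternating_vandermonde alternating_zero)
  have "inj_on (real \<circ> h) F"
    using \<open>inj_on h F\<close> by (simp add: inj_on_def)
  then have "\<phi> vs \<noteq> 0"
    using vs by (simp add: \<phi>_def vandermonde_eq_0_iff)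
  moreover have "vs \<in> ordered_faces K i"
    using assms vs by (simp add: ordered_faces_def)
  moreover have "\<phi> ws = 0" if "set ws \<noteq> F" for ws
    using that by (simp add: \<phi>_def)
  ultimately show thesis
    using vs(3) by (intro that[OF cochain_of_in_cochains[OF alt]]) (simp_all add: cochain_of_oriented[OF alt])
qed

lemma cochain_inner_cmult_right:
  "cochain_inner K w i f (\<lambda>c. k * g c) = k * cochain_inner K w i f g"
  unfolding cochain_inner_def sum_distrib_left by (simp add: mult_ac)

text \<open>Positive definiteness: a sum of nonnegative terms vanishes only if each term does, and
  the weights are positive.\<close>

lemma cochain_inner_self_eq_0:
  assumes "finite_complex K" "\<And>F. F \<in> faces K i \<Longrightarrow> w F > 0" "f \<in> cochains K i"
    and "cochain_inner K w i f f = 0"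
  shows "f = (\<lambda>_. 0)"
proof (rule cochains_eqI[OF assms(3)])
  show "(\<lambda>_. 0) \<in> cochains K i"
    using cochains_cmult[OF assms(3), of 0] by simp
  fix vs
  assume vs: "vs \<in> ordered_faces K i"
  have "\<forall>F\<in>faces K i. w F * f (some_orientation F) * f (some_orientation F) = 0"
    using assms(4) unfolding cochain_inner_def
    by (subst (asm) sum_nonneg_eq_0_iff)
       (use assms(1,2) in \<open>auto simp: finite_complex_facesD mult.assoc less_imp_le\<close>)
  then have "f (some_orientation (set vs)) * f (some_orientation (set vs)) = 0"
    using vs assms(2) by (force simp: ordered_faces_def)
  then show "f (oriented vs) = 0"
    using some_orientation_prod[OF assms(3,3), of vs] vs by (simp add: ordered_faces_def)
qed

text \<open>Makes the \<open>THE\<close> in \<open>coboundary_adjoint\<close> meaningful. It is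
  Riesz representation for the functional that sends \<open>f\<close> to the inner product of its
  coboundary with \<open>h\<close>.\<close>

lemma ex1_coboundary_adjoint:
  assumes K: "finite_complex K" and w: "\<And>F. F \<in> faces K i \<Longrightarrow> w F > 0"
  shows "\<exists>!g. g \<in> cochains K i \<and> (\<forall>f\<in>cochains K i.
    cochain_inner K w (Suc i) (coboundary K i f) h = cochain_inner K w i f g)"
proof -
  let ?\<phi> = "\<lambda>f. cochain_inner K w (Suc i) (coboundary K i f) h"
  have "\<forall>F\<in>faces K i. \<exists>e. e \<in> cochains K i \<and> e (some_orientation F) = 1 \<and>
      (\<forall>vs. set vs \<noteq> F \<longrightarrow> e (oriented vs) = 0)"
    using ex_cochain_supported_on finite_complex_facesD(2)[OF K] by metis
  then obtain e where e: "\<And>F. F \<in> faces K i \<Longrightarrow> e F \<in> cochains K i"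
    "\<And>F. F \<in> faces K i \<Longrightarrow> e F (some_orientation F) = 1"
    "\<And>F vs. F \<in> faces K i \<Longrightarrow> set vs \<noteq> F \<Longrightarrow> e F (oriented vs) = 0"
    by metis
  \<comment> \<open>At a given face all the cochains \<open>e F\<close> but its own vanish.\<close>
  have delta: "(\<Sum>F\<in>faces K i. a F * e F (oriented vs)) = a (set vs) * e (set vs) (oriented vs)"
    if "set vs \<in> faces K i" for a vs
  proof -
    have "(\<Sum>F\<in>faces K i. a F * e F (oriented vs)) =
        (\<Sum>F\<in>faces K i. if F = set vs then a F * e F (oriented vs) else 0)"
      by (rule sum.cong) (use e(3) in auto)
    then show ?thesis
      using that finite_complex_facesD(1)[OF K] by (simp)
  qed
  \<comment> \<open>Both sides agree on the chosen orientation of each face, hence on all its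
    orderings.\<close>
  have expand: "f = (\<lambda>c. \<Sum>F\<in>faces K i. f (some_orientation F) * e F c)"
    if f: "f \<in> cochains K i" for f
  proof (rule cochains_eqI[OF f cochains_lincomb])
    fix vs
    assume "vs \<in> ordered_faces K i"
    then have vs: "distinct vs" "set vs \<in> faces K i"
      by (auto simp: ordered_faces_def)
    obtain ws where ws: "distinct ws" "set ws = set vs" "some_orientation (set vs) = oriented ws"
      by (rule some_orientationE[OF finite_set])
    have "f (oriented vs) = f (some_orientation (set vs)) * e (set vs) (oriented vs)"
    proof (rule alternating_eqI[of "\<lambda>l. f (oriented l)" "\<lambda>l. f (some_orientation (set vs)) * e (set vs) (oriented l)" ws])
      show "alternating (\<lambda>l. f (some_orientation (set vs)) * e (set vs) (oriented l))"
        using e(1)[OF vs(2)] by (intro alternating_cmult cochains_alternating)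
      show "f (oriented ws) = f (some_orientation (set vs)) * e (set vs) (oriented ws)"
        using e(2)[OF vs(2)] ws(3) by simp
    qed (use vs ws cochains_alternating[OF f] in auto)
    then show "f (oriented vs) = (\<Sum>F\<in>faces K i. f (some_orientation F) * e F (oriented vs))"
      using delta[OF vs(2)] by simp
  qed (rule e)
  text \<open>The cochains \<open>e F\<close> form an orthogonal basis, which determines the adjoint.\<close>
  define g where "g = (\<lambda>c. \<Sum>F\<in>faces K i. (?\<phi> (e F) / w F) * e F c)"
  have "g (some_orientation F) = ?\<phi> (e F) / w F" if F: "F \<in> faces K i" for F
  proof -
    obtain ws where ws: "distinct ws" "set ws = F" "some_orientation F = oriented ws"
      using some_orientationE[OF finite_complex_facesD(2)[OF K F]] by blast
    show ?thesis
      using delta[of ws "\<lambda>F. ?\<phi> (e F) / w F"] e(2)[OF F] F ws by (simp add: g_def)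
  qed
  then have inner_g: "cochain_inner K w i f g = (\<Sum>F\<in>faces K i. f (some_orientation F) * ?\<phi> (e F))" for f
    unfolding cochain_inner_def by (intro sum.cong) (use w in force)+
  have repr: "?\<phi> f = cochain_inner K w i f g" if f: "f \<in> cochains K i" for f
  proof -
    have "?\<phi> f = (\<Sum>F\<in>faces K i. f (some_orientation F) * ?\<phi> (e F))"
      by (subst expand[OF f], subst coboundary_lincomb)
         (simp add: cochain_inner_def sum_distrib_left sum_distrib_right mult_ac sum.swap[of _ "faces K i"])
    then show ?thesis
      by (simp add: inner_g)
  qed
  have g: "g \<in> cochains K i"
    unfolding g_def by (rule cochains_lincomb) (rule e)
  have unique: "g1 = g2"
    if "g1 \<in> cochains K i" "\<forall>f\<in>cochains K i. ?\<phi> f = cochain_inner K w i f g1"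
      "g2 \<in> cochains K i" "\<forall>f\<in>cochains K i. ?\<phi> f = cochain_inner K w i f g2" for g1 g2
  proof -
    \<comment> \<open>Two representing cochains are tested against their own difference.\<close>
    let ?d = "\<lambda>c. g1 c - g2 c"
    have d: "?d \<in> cochains K i"
      using that by (intro cochains_diff)
    then have "cochain_inner K w i ?d g1 = cochain_inner K w i ?d g2"
      using that by metis
    then have "cochain_inner K w i ?d ?d = 0"
      by (simp add: cochain_inner_def right_diff_distrib sum_subtractf)
    then have "?d = (\<lambda>_. 0)"
      using cochain_inner_self_eq_0[where w = w, OF K w d] by blast
    then show ?thesis
      by (metis eq_iff_diff_eq_0 ext)
  qed
  show ?thesis
  proof (rule ex1I[of _ g])
    show "g \<in> cochains K i \<and> (\<forall>f\<in>cochains K i. ?\<phi> f = cochain_inner K w i f g)"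
      using g repr by simp
    show "g' = g" if "g' \<in> cochains K i \<and> (\<forall>f\<in>cochains K i. ?\<phi> f = cochain_inner K w i f g')" for g'
      by (rule unique) (use that g repr in simp_all)
  qed
qed

section \<open>Positivity of the normalized weight and the weak equation\<close>

lemma ex_coface:
  assumes "finite_complex K" "F \<in> K" "\<not> facet K F"
  obtains G where "G \<in> K" "card G = Suc (card F)" "F \<subset> G"
proof -
  obtain H where H: "H \<in> K" "F \<subset> H"
    using assms by (auto simp: facet_def)
  then obtain v where v: "v \<in> H" "v \<notin> F"
    by blast
  \<comment> \<open>Adding a single vertex of a strictly larger face gives a face, by downward
    closure.\<close>
  have "insert v F \<subseteq> H"
    using H v by blast
  then have "insert v F \<in> K" "finite F"
    using assms(1,2) H(1) unfolding finite_complex_def by simp_all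
  then show thesis
    using v by (intro that[of "insert v F"]) auto
qed

text \<open>Away from facets the weight is a sum over cofaces, and \<open>ex_coface\<close> supplies
  at least one. Positivity makes the inner products definite and thus the adjoint unique.\<close>

lemma normalized_weight_pos:
  assumes "finite_complex K" "F \<in> K"
  shows "normalized_weight K F > 0"
  using assms
proof (induction K F rule: normalized_weight.induct)
  case (1 K F)
  show ?case
  proof (cases "facet K F")
    case True
    then show ?thesis
      using 1(2) by (simp add: normalized_weight_facet)
  next
    case False
    have "finite {G \<in> K. card G = Suc (card F) \<and> F \<subset> G}"
      using 1(2) by (simp add: finite_complex_def)
    moreover have "{G \<in> K. card G = Suc (card F) \<and> F \<subset> G} \<noteq> {}"
      by (rule ex_coface[OF 1(2,3) False]) auto
    ultimately show ?thesis
      unfolding normalized_weight_nonfacet[OF 1(2,3) False] degree_def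
    proof (rule sum_pos)
      fix G
      assume "G \<in> {G \<in> K. card G = Suc (card F) \<and> F \<subset> G}"
      then show "normalized_weight K G > 0"
        using 1 False by simp
    qed
  qed
qed

text \<open>By existence and uniqueness of the adjoint, the Laplacian of \<open>f\<close> equals
  \<open>lam\<close> times \<open>f\<close> iff the latter represents the functional. Only inner
  products remain, and these can be split over two complexes.\<close>

lemma eigenfunction_iff_weak:
  assumes "finite_complex K"
  shows "eigenfunction K i lam f \<longleftrightarrow> f \<in> cochains K i \<and> f \<noteq> (\<lambda>_. 0) \<and>
    (\<forall>g\<in>cochains K i. cochain_inner K (normalized_weight K) (Suc i) (coboundary K i g) (coboundary K i f) =
      lam * cochain_inner K (normalized_weight K) i g f)"
proof -
  let ?w = "normalized_weight K"
  let ?P = "\<lambda>h. h \<in> cochains K i \<and> (\<forall>g\<in>cochains K i.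
    cochain_inner K ?w (Suc i) (coboundary K i g) (coboundary K i f) = cochain_inner K ?w i g h)"
  have ex1: "\<exists>!h. ?P h"
    using assms by (intro ex1_coboundary_adjoint) (auto simp: faces_def normalized_weight_pos)
  have THE: "normalized_up_laplacian K i f = (THE h. ?P h)"
    by (simp add: normalized_up_laplacian_def up_laplacian_def coboundary_adjoint_def)
  have "normalized_up_laplacian K i f = (\<lambda>c. lam * f c) \<longleftrightarrow> ?P (\<lambda>c. lam * f c)"
  proof
    assume eq: "normalized_up_laplacian K i f = (\<lambda>c. lam * f c)"
    show "?P (\<lambda>c. lam * f c)"
      using theI'[OF ex1, folded THE] unfolding eq .
  next
    assume "?P (\<lambda>c. lam * f c)"
    then show "normalized_up_laplacian K i f = (\<lambda>c. lam * f c)"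
      unfolding THE by (rule the1_equality[OF ex1])
  qed
  then show ?thesis
    unfolding eigenfunction_def using cochains_cmult[of f K i lam]
    by (simp only: cochain_inner_cmult_right) blast
qed

text \<open>Test the weak equation with the cochain \<open>e\<close> supported on the facet. Its
  coboundary vanishes, as no larger face contains the facet, and the other side is a positive weight
  times \<open>lam\<close> times the value of \<open>f\<close>.\<close>

lemma eigenfunction_zero_on_facet:
  assumes K: "finite_complex K" and f: "eigenfunction K i lam f"
    and vs: "vs \<in> ordered_faces K i" and facet: "facet K (set vs)"
  shows "lam * f (oriented vs) = 0"
proof -
  let ?F = "set vs" and ?w = "normalized_weight K"
  have F: "?F \<in> faces K i" "distinct vs"
    using vs by (auto simp: ordered_faces_def)
  obtain e where e: "e \<in> cochains K i" "e (some_orientation ?F) = 1"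
    "\<And>ws. set ws \<noteq> ?F \<Longrightarrow> e (oriented ws) = 0"
    using ex_cochain_supported_on[OF F(1)] by blast
  have f': "f \<in> cochains K i"
    using f by (simp add: eigenfunction_def)
  have coboundary_e: "coboundary K i e (some_orientation G) = 0" if G: "G \<in> faces K (Suc i)" for G
  proof -
    obtain ws where ws: "distinct ws" "set ws = G" "some_orientation G = oriented ws"
      using some_orientationE[OF finite_complex_facesD(2)[OF K G]] by blast
    have "set (take j ws @ drop (Suc j) ws) \<subseteq> G" for j
      using ws(2) by (auto dest: in_set_takeD in_set_dropD)
    \<comment> \<open>A facet contained in \<open>G\<close> would equal \<open>G\<close>, but
      \<open>G\<close> has one more vertex.\<close>
    moreover have "\<not> ?F \<subseteq> G"
      using facet G F(1) by (auto simp: facet_def faces_def)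
    ultimately have "e (oriented (take j ws @ drop (Suc j) ws)) = 0" for j
      using e(3) by metis
    then show ?thesis
      using ws G e(1) by (simp add: coboundary_oriented ordered_faces_def boundary_sum_conv_sum)
  qed
  have "e (some_orientation G) = 0" if "G \<in> faces K i" "G \<noteq> ?F" for G
    using some_orientationE[OF finite_complex_facesD(2)[OF K that(1)]] e(3) that(2) by metis
  then have "cochain_inner K ?w i e f =
      (\<Sum>G\<in>faces K i. if G = ?F then ?w G * f (some_orientation G) else 0)"
    unfolding cochain_inner_def using e(2) by (intro sum.cong) auto
  also have "\<dots> = ?w ?F * f (some_orientation ?F)"
    using F(1) finite_complex_facesD(1)[OF K] by (simp)
  finally have "lam * (?w ?F * f (some_orientation ?F)) = 0"
    using f e(1) coboundary_e unfolding eigenfunction_iff_weak[OF K] by (auto simp: cochain_inner_def)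
  moreover have "?w ?F \<noteq> 0"
    using normalized_weight_pos[OF K, of ?F] F(1) by (simp add: faces_def)
  \<comment> \<open>Multiplying by the value once more gives a product independent of the
    orientation, which transfers to \<open>vs\<close>.\<close>
  ultimately have "lam * (f (some_orientation ?F) * f (some_orientation ?F)) = 0"
    by simp
  then show ?thesis
    unfolding some_orientation_prod[OF f' f' F(2)] by simp
qed
subsection \<open>Gluing along a face\<close>

text \<open>Restriction of a cochain along a vertex map. An oriented face is a set of lists, so
  \<open>map h\<close> acts on it by taking the image; the zero branch keeps the convention that
  cochains vanish off the oriented faces.\<close>

definition pullback ::
    "'a set set \<Rightarrow> nat \<Rightarrow> ('a \<Rightarrow> 'b) \<Rightarrow> ('b list set \<Rightarrow> real) \<Rightarrow> 'a list set \<Rightarrow> real" where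
  "pullback L i h g c = (if c \<in> oriented_faces L i then g (map h ` c) else 0)"

lemma pullback_oriented:
  "pullback L i h g (oriented vs) = (if vs \<in> ordered_faces L i then g (oriented (map h vs)) else 0)"
  by (simp add: pullback_def oriented_mem_oriented_faces_iff oriented_map)

lemma pullback_in_cochains:
  assumes "g \<in> cochains K i"
  shows "pullback L i h g \<in> cochains L i"
  unfolding cochains_iff pullback_oriented
  by (intro conjI alternating_if_ordered_faces alternating_map cochains_alternating[OF assms])
     (simp add: pullback_def)

lemma ordered_faces_delete:
  assumes "finite_complex L" "vs \<in> ordered_faces L (Suc i)" "j \<le> Suc i"
  shows "take j vs @ drop (Suc j) vs \<in> ordered_faces L i"
proof -
  let ?ws = "take j vs @ drop (Suc j) vs"
  have vs: "distinct vs" "set vs \<in> L" "length vs = Suc (Suc i)"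
    using assms(2) by (auto simp: ordered_faces_def faces_def distinct_card)
  have "distinct ?ws"
    using vs(1) set_take_disj_set_drop_if_distinct[of vs j "Suc j"] by simp
  moreover have "set ?ws \<subseteq> set vs"
    by (auto dest: in_set_takeD in_set_dropD)
  then have "set ?ws \<in> L"
    using assms(1) vs(2) unfolding finite_complex_def by blast
  moreover have "length ?ws = Suc i"
    using vs(3) assms(3) by simp
  ultimately show ?thesis
    by (simp add: ordered_faces_def faces_def distinct_card del: set_append length_append)
qed

lemma ordered_faces_map:
  assumes "inj h" "\<And>F. F \<in> L \<Longrightarrow> h ` F \<in> K" "vs \<in> ordered_faces L i"
  shows "map h vs \<in> ordered_faces K i"
  using assms inj_on_subset[OF assms(1)]
  by (auto simp: ordered_faces_def faces_def distinct_map card_image)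

text \<open>Deleting an entry commutes with \<open>map h\<close>, and each deletion is again an
  ordered face of \<open>L\<close>, so the cutoff in \<open>pullback\<close> does not affect the
  sum.\<close>

lemma coboundary_pullback:
  assumes "finite_complex L" "inj h" "\<And>F. F \<in> L \<Longrightarrow> h ` F \<in> K" "g \<in> cochains K i"
  shows "coboundary L i (pullback L i h g) = pullback L (Suc i) h (coboundary K i g)"
proof (rule cochains_eqI)
  show "coboundary L i (pullback L i h g) \<in> cochains L (Suc i)"
    by (rule coboundary_in_cochains[OF pullback_in_cochains[OF assms(4)]])
  show "pullback L (Suc i) h (coboundary K i g) \<in> cochains L (Suc i)"
    by (rule pullback_in_cochains[OF coboundary_in_cochains[OF assms(4)]])
  fix vs
  assume vs: "vs \<in> ordered_faces L (Suc i)"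
  then have "length vs = Suc (Suc i)"
    by (auto simp: ordered_faces_def faces_def distinct_card)
  then have "pullback L i h g (oriented (take j vs @ drop (Suc j) vs)) =
      g (oriented (take j (map h vs) @ drop (Suc j) (map h vs)))" if "j < length vs" for j
    using ordered_faces_delete[OF assms(1) vs, of j] that
    by (simp add: pullback_oriented take_map drop_map)
  then have "boundary_sum (\<lambda>l. pullback L i h g (oriented l)) vs =
      boundary_sum (\<lambda>l. g (oriented l)) (map h vs)"
    unfolding boundary_sum_conv_sum length_map by (intro sum.cong) simp_all
  then show "coboundary L i (pullback L i h g) (oriented vs) =
      pullback L (Suc i) h (coboundary K i g) (oriented vs)"
    using vs by (simp add: pullback_oriented coboundary_oriented[OF assms(4) ordered_faces_map[OF assms(2,3) vs]]
        coboundary_oriented[OF pullback_in_cochains[OF assms(4)] vs])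
qed

text \<open>The chosen orientations of \<open>F\<close> and of its image need not correspond, so
  only products of two values are compared.\<close>

lemma pullback_prod:
  assumes "f \<in> cochains K i" "g \<in> cochains K i" "inj h" "F \<in> faces L i" "finite F"
  shows "f (some_orientation (h ` F)) * g (some_orientation (h ` F)) =
    pullback L i h f (some_orientation F) * pullback L i h g (some_orientation F)"
proof -
  obtain vs where vs: "distinct vs" "set vs = F" "some_orientation F = oriented vs"
    using some_orientationE[OF assms(5)] by blast
  have "distinct (map h vs)"
    using vs(1) inj_on_subset[OF assms(3) subset_UNIV] by (simp add: distinct_map)
  then show ?thesis
    using some_orientation_prod[OF assms(1,2), of "map h vs"] vs assms(4)
    by (simp add: pullback_oriented ordered_faces_def)
qed

section \<open>Normalized weights under injective vertex maps\<close>

lemma image_cofaces: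
  assumes "inj h"
  shows "image h ` {G \<in> L. card G = Suc (card F) \<and> F \<subset> G} =
    {G \<in> image h ` L. card G = Suc (card (h ` F)) \<and> h ` F \<subset> G}"
  by (simp only: Compr_image_eq card_image[OF inj_on_subset[OF assms subset_UNIV]] psubset_eq
      inj_image_subset_iff[OF assms] inj_image_eq_iff[OF assms])

text \<open>The weight recursion looks only at faces above \<open>F\<close>. The last hypothesis
  says that every face of \<open>K\<close> above the image comes from \<open>L\<close>, so both
  recursions agree; the induction runs from large faces to small ones.\<close>

lemma normalized_weight_embedding:
  assumes h: "inj h" and sub: "\<And>F. F \<in> L \<Longrightarrow> h ` F \<in> K"
    and K: "finite_complex K" and L: "finite_complex L"
    and "F \<in> L" "\<And>G. G \<in> K \<Longrightarrow> h ` F \<subseteq> G \<Longrightarrow> G \<in> image h ` L"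
  shows "normalized_weight K (h ` F) = normalized_weight L F"
  using assms(5,6)
proof (induction "card (\<Union>L) - card F" arbitrary: F rule: less_induct)
  case less
  note up = less.prems(2)
  have facet_iff: "facet K (h ` F) \<longleftrightarrow> facet L F"
  proof
    assume *: "facet K (h ` F)"
    have "G = F" if "G \<in> L" "F \<subseteq> G" for G
    proof -
      have "h ` G = h ` F"
        using * sub[OF that(1)] image_mono[OF that(2), of h] by (simp add: facet_def)
      then show ?thesis
        by (simp add: inj_image_eq_iff[OF h])
    qed
    then show "facet L F"
      using less.prems(1) by (simp add: facet_def)
  next
    assume *: "facet L F"
    have "G = h ` F" if G: "G \<in> K" "h ` F \<subseteq> G" for G
    proof -
      obtain H where H: "H \<in> L" "G = h ` H"
        using up[OF G] by (rule imageE)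
      then have "F \<subseteq> H"
        using G(2) by (simp add: inj_image_subset_iff[OF h])
      then have "H = F"
        using * H(1) by (simp add: facet_def)
      then show ?thesis
        by (simp add: H(2))
    qed
    then show "facet K (h ` F)"
      using sub[OF less.prems(1)] by (simp add: facet_def)
  qed
  show ?case
  proof (cases "facet L F")
    case True
    then show ?thesis
      using K L facet_iff by (simp add: normalized_weight_facet)
  next
    case False
    let ?C = "{G \<in> L. card G = Suc (card F) \<and> F \<subset> G}"
    have "{G \<in> K. card G = Suc (card (h ` F)) \<and> h ` F \<subset> G} = image h ` ?C"
      unfolding image_cofaces[OF h] using sub up by blast
    moreover have "normalized_weight K (h ` G) = normalized_weight L G" if G: "G \<in> ?C" for G
    proof (rule less.hyps)
      have "finite (\<Union>L)" "G \<subseteq> \<Union>L"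
        using L G by (auto simp: finite_complex_def)
      then have "card G \<le> card (\<Union>L)"
        by (rule card_mono)
      then show "card (\<Union>L) - card G < card (\<Union>L) - card F"
        using G by simp
      show "G \<in> L"
        using G by simp
      show "H \<in> image h ` L" if "H \<in> K" "h ` G \<subseteq> H" for H
        using that G by (intro up) auto
    qed
    moreover have "inj_on (image h) ?C"
      using h by (simp add: inj_on_def inj_image_eq_iff)
    ultimately show ?thesis
      using False facet_iff sub[OF less.prems(1)] less.prems(1) K L
      by (simp add: normalized_weight_nonfacet degree_def sum.reindex)
  qed
qed

lemma finite_complex_image:
  assumes "finite_complex L"
  shows "finite_complex (image h ` L)"
proof -
  have "G \<in> image h ` L" if "F \<in> L" "G \<subseteq> h ` F" for F G
  proof -
    obtain H where "H \<subseteq> F" "G = h ` H"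
      using \<open>G \<subseteq> h ` F\<close> by (auto simp: subset_image_iff)
    then show ?thesis
      using \<open>F \<in> L\<close> assms by (auto simp: finite_complex_def)
  qed
  then have "\<forall>F\<in>image h ` L. \<forall>G. G \<subseteq> F \<longrightarrow> G \<in> image h ` L"
    by (simp only: ball_simps) blast
  moreover have "{} \<in> image h ` L"
    using assms by (auto simp: finite_complex_def image_iff intro!: bexI[of _ "{}"])
  ultimately show ?thesis
    using assms unfolding finite_complex_def by simp
qed

lemma finite_complex_Un:
  assumes "finite_complex K" "finite_complex L"
  shows "finite_complex (K \<union> L)"
  using assms unfolding finite_complex_def by (simp add: ball_Un)

text \<open>An abstract form of the wedge: two injective vertex maps whose ranges meet only in the
  glued face. It keeps equivalence classes out of the argument.\<close>

locale face_gluing =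
  fixes h1 :: "'a \<Rightarrow> 'c" and h2 :: "'b \<Rightarrow> 'c" and K1 :: "'a set set" and K2 :: "'b set set"
    and vs :: "'a list" and us :: "'b list" and i :: nat and K :: "'c set set"
  assumes complex1: "finite_complex K1" and complex2: "finite_complex K2"
    and inj1: "inj h1" and inj2: "inj h2"
    and vs: "vs \<in> ordered_faces K1 i" and us: "us \<in> ordered_faces K2 i"
    and glue: "map h1 vs = map h2 us"
    and range_Int: "range h1 \<inter> range h2 \<subseteq> h1 ` set vs"
    and K_eq: "K = image h1 ` K1 \<union> image h2 ` K2"
begin

text \<open>The symmetry that carries each one-sided result over to \<open>h2\<close>; the glued
  face has the same image under both maps.\<close>

lemma flip: "face_gluing h2 h1 K2 K1 us vs i K"
proof -
  have "h1 ` set vs = h2 ` set us"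
    using glue by (metis set_map)
  then show ?thesis
    using range_Int K_eq by unfold_locales (auto intro: complex1 complex2 inj1 inj2 vs us glue[symmetric])
qed

lemma image_us_eq: "h2 ` set us = h1 ` set vs"
  using glue by (metis set_map)

lemma finite_complex_K: "finite_complex K"
  unfolding K_eq by (intro finite_complex_Un finite_complex_image complex1 complex2)

lemma image_h1_in_K: "F \<in> K1 \<Longrightarrow> h1 ` F \<in> K"
  unfolding K_eq by blast

lemma set_vs: "set vs \<in> K1" "card (set vs) = Suc i" "finite (set vs)" "distinct vs"
  using vs by (auto simp: ordered_faces_def faces_def)

lemma card_h1: "card (h1 ` F) = card F"
  by (rule card_image[OF inj_on_subset[OF inj1 subset_UNIV]])

text \<open>The image of \<open>F\<close> lies in both ranges, hence in the glued face, and
  injectivity carries the inclusion back.\<close>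

lemma subset_set_vs:
  assumes "h1 ` F \<subseteq> range h2"
  shows "F \<subseteq> set vs"
proof -
  have "h1 ` F \<subseteq> h1 ` set vs"
    using assms range_Int by blast
  then show ?thesis
    by (simp add: inj_image_subset_iff[OF inj1])
qed

lemma eq_set_vs:
  assumes "h1 ` F \<subseteq> range h2" "card F \<ge> Suc i"
  shows "F = set vs"
  using subset_set_vs[OF assms(1)] assms(2) set_vs by (simp add: card_seteq)

text \<open>Otherwise \<open>G\<close> comes from \<open>K2\<close>, which puts the image of
  \<open>F\<close> into the range of \<open>h2\<close> and, by cardinality, makes \<open>F\<close>
  the glued face. So from dimension \<open>i\<close> on, only the glued face can gain new faces
  above it.\<close>

lemma coface_in_image:
  assumes "card F \<ge> Suc i" "F \<noteq> set vs" "G \<in> K" "h1 ` F \<subseteq> G"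
  shows "G \<in> image h1 ` K1"
proof (rule ccontr)
  assume "G \<notin> image h1 ` K1"
  then have "h1 ` F \<subseteq> range h2"
    using assms(3,4) unfolding K_eq by blast
  then show False
    using eq_set_vs[of F] assms(1,2) by simp
qed

lemma normalized_weight_h1:
  assumes "F \<in> K1" "card F \<ge> Suc i" "F \<noteq> set vs"
  shows "normalized_weight K (h1 ` F) = normalized_weight K1 F"
  by (rule normalized_weight_embedding[OF inj1 image_h1_in_K finite_complex_K complex1 assms(1) coface_in_image[OF assms(2,3)]])

text \<open>The cofaces in \<open>K\<close> come from \<open>K1\<close> or from \<open>K2\<close>
  and keep their weights, so the two degrees add. A facet has weight 1 instead of its degree 0,
  which would spoil the count.\<close>

lemma normalized_weight_glued_face:
  assumes "\<not> facet K1 (set vs)" "\<not> facet K2 (set us)"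
  shows "normalized_weight K (h1 ` set vs) =
    normalized_weight K1 (set vs) + normalized_weight K2 (set us)"
proof -
  interpret flip: face_gluing h2 h1 K2 K1 us vs i K
    by (rule flip)
  let ?Z = "h1 ` set vs"
  define C1 where "C1 = {G \<in> K1. card G = Suc (card (set vs)) \<and> set vs \<subset> G}"
  define C2 where "C2 = {G \<in> K2. card G = Suc (card (set us)) \<and> set us \<subset> G}"
  obtain H where "H \<in> K1" "set vs \<subset> H"
    using assms(1) set_vs(1) unfolding facet_def by blast
  then have "h1 ` H \<in> K" "?Z \<subseteq> h1 ` H" "?Z \<noteq> h1 ` H"
    using image_h1_in_K inj1 by (auto simp: inj_image_eq_iff)
  then have nonfacet: "\<not> facet K ?Z"
    unfolding facet_def by metis
  have cofaces: "{G \<in> K. card G = Suc (card ?Z) \<and> ?Z \<subset> G} = image h1 ` C1 \<union> image h2 ` C2"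
    unfolding C1_def C2_def image_cofaces[OF inj1] image_cofaces[OF inj2] image_us_eq unfolding K_eq by blast
  have finite: "finite C1" "finite C2"
    using complex1 complex2 by (simp_all add: C1_def C2_def finite_complex_def)
  \<comment> \<open>A common coface would lie in the range of \<open>h2\<close>, hence inside the
    glued face itself.\<close>
  have disjoint: "image h1 ` C1 \<inter> image h2 ` C2 = {}"
  proof (rule ccontr)
    assume "image h1 ` C1 \<inter> image h2 ` C2 \<noteq> {}"
    then obtain G H where "G \<in> C1" "h1 ` G = h2 ` H"
      by auto
    then show False
      using subset_set_vs[of G] by (auto simp: C1_def)
  qed
  have w1: "normalized_weight K (h1 ` G) = normalized_weight K1 G" if "G \<in> C1" for G
    by (rule normalized_weight_h1) (use that set_vs(2) in \<open>auto simp: C1_def\<close>)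
  have w2: "normalized_weight K (h2 ` G) = normalized_weight K2 G" if "G \<in> C2" for G
    by (rule flip.normalized_weight_h1) (use that flip.set_vs(2) in \<open>auto simp: C2_def\<close>)
  have "normalized_weight K ?Z = (\<Sum>G\<in>image h1 ` C1. normalized_weight K G) + (\<Sum>G\<in>image h2 ` C2. normalized_weight K G)"
    unfolding normalized_weight_nonfacet[OF finite_complex_K image_h1_in_K[OF set_vs(1)] nonfacet] degree_def cofaces
    using finite disjoint by (intro sum.union_disjoint) auto
  also have "(\<Sum>G\<in>image h1 ` C1. normalized_weight K G) = (\<Sum>G\<in>C1. normalized_weight K1 G)"
    by (subst sum.reindex) (simp_all add: w1 inj_on_def inj_image_eq_iff[OF inj1])
  also have "(\<Sum>G\<in>image h2 ` C2. normalized_weight K G) = (\<Sum>G\<in>C2. normalized_weight K2 G)"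
    by (subst sum.reindex) (simp_all add: w2 inj_on_def inj_image_eq_iff[OF inj2])
  finally show ?thesis
    by (simp add: C1_def C2_def normalized_weight_nonfacet[OF complex1 set_vs(1) assms(1)]
        normalized_weight_nonfacet[OF complex2 flip.set_vs(1) assms(2)] degree_def)
qed

text \<open>Away from the glued face both weights and products of cochain values are preserved. The
  set \<open>S\<close> will be all faces in dimension \<open>Suc i\<close>, and all but the glued
  one in dimension \<open>i\<close>.\<close>

lemma inner_image_h1:
  assumes "f \<in> cochains K j" "g \<in> cochains K j" "i \<le> j" "S \<subseteq> faces K1 j" "set vs \<notin> S"
  shows "(\<Sum>G\<in>image h1 ` S. normalized_weight K G * f (some_orientation G) * g (some_orientation G)) =
    (\<Sum>F\<in>S. normalized_weight K1 F * pullback K1 j h1 f (some_orientation F) *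
      pullback K1 j h1 g (some_orientation F))"
proof (subst sum.reindex)
  show "inj_on (image h1) S"
    using inj1 by (simp add: inj_on_def inj_image_eq_iff)
  have "normalized_weight K (h1 ` F) = normalized_weight K1 F"
    "f (some_orientation (h1 ` F)) * g (some_orientation (h1 ` F)) =
      pullback K1 j h1 f (some_orientation F) * pullback K1 j h1 g (some_orientation F)" if "F \<in> S" for F
  proof -
    have F: "F \<in> faces K1 j" "F \<noteq> set vs"
      using that assms(4,5) by auto
    then show "normalized_weight K (h1 ` F) = normalized_weight K1 F"
      using assms(3) by (intro normalized_weight_h1) (auto simp: faces_def)
    show "f (some_orientation (h1 ` F)) * g (some_orientation (h1 ` F)) =
      pullback K1 j h1 f (some_orientation F) * pullback K1 j h1 g (some_orientation F)"
      by (rule pullback_prod[OF assms(1,2) inj1 F(1) finite_complex_facesD(2)[OF complex1 F(1)]])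
  qed
  then show "sum ((\<lambda>G. normalized_weight K G * f (some_orientation G) * g (some_orientation G)) \<circ> image h1) S =
    (\<Sum>F\<in>S. normalized_weight K1 F * pullback K1 j h1 f (some_orientation F) *
      pullback K1 j h1 g (some_orientation F))"
    by (intro sum.cong) (simp_all add: mult.assoc)
qed

lemma faces_K_eq: "faces K j = image h1 ` faces K1 j \<union> image h2 ` faces K2 j"
proof -
  interpret flip: face_gluing h2 h1 K2 K1 us vs i K
    by (rule flip)
  show ?thesis
    unfolding faces_def K_eq by (auto simp: card_h1 flip.card_h1)
qed

lemma faces_disjoint:
  assumes "i \<le> j" "F \<in> faces K1 j" "F \<noteq> set vs"
  shows "h1 ` F \<notin> range (image h2)"
  using eq_set_vs[of F] assms by (auto simp: faces_def)

text \<open>A face shared by both sides lies in the glued \<open>i\<close>-face, so the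
  \<open>(i+1)\<close>-faces of the two sides are disjoint and the sum splits.\<close>

lemma cochain_inner_glued_Suc:
  assumes "f \<in> cochains K (Suc i)" "g \<in> cochains K (Suc i)"
  shows "cochain_inner K (normalized_weight K) (Suc i) f g =
    cochain_inner K1 (normalized_weight K1) (Suc i) (pullback K1 (Suc i) h1 f) (pullback K1 (Suc i) h1 g) +
    cochain_inner K2 (normalized_weight K2) (Suc i) (pullback K2 (Suc i) h2 f) (pullback K2 (Suc i) h2 g)"
proof -
  interpret flip: face_gluing h2 h1 K2 K1 us vs i K
    by (rule flip)
  have notin: "set vs \<notin> faces K1 (Suc i)" "set us \<notin> faces K2 (Suc i)"
    using set_vs(2) flip.set_vs(2) by (auto simp: faces_def)
  have "image h1 ` faces K1 (Suc i) \<inter> image h2 ` faces K2 (Suc i) = {}"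
    using faces_disjoint[of "Suc i"] notin by fastforce
  then show ?thesis
    unfolding cochain_inner_def faces_K_eq
    using inner_image_h1[OF assms _ subset_refl notin(1)] flip.inner_image_h1[OF assms _ subset_refl notin(2)]
      finite_complex_facesD(1)[OF complex1] finite_complex_facesD(1)[OF complex2]
    by (subst sum.union_disjoint) simp_all
qed

text \<open>The glued face contributes to all three inner products; the equation is arranged so that no
  subtraction occurs.\<close>

lemma cochain_inner_glued:
  fixes f g
  defines "t \<equiv> f (oriented (map h1 vs)) * g (oriented (map h1 vs))"
  assumes "f \<in> cochains K i" "g \<in> cochains K i"
  shows "cochain_inner K (normalized_weight K) i f g +
      (normalized_weight K1 (set vs) + normalized_weight K2 (set us)) * t =
    cochain_inner K1 (normalized_weight K1) i (pullback K1 i h1 f) (pullback K1 i h1 g) +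
    cochain_inner K2 (normalized_weight K2) i (pullback K2 i h2 f) (pullback K2 i h2 g) +
    normalized_weight K (h1 ` set vs) * t"
proof -
  interpret flip: face_gluing h2 h1 K2 K1 us vs i K
    by (rule flip)
  let ?S1 = "faces K1 i - {set vs}" and ?S2 = "faces K2 i - {set us}" and ?Z = "h1 ` set vs"
  have finite: "finite (faces K1 i)" "finite (faces K2 i)"
    by (intro finite_complex_facesD(1) complex1 complex2)+
  have mem: "set vs \<in> faces K1 i" "set us \<in> faces K2 i"
    using vs us by (auto simp: ordered_faces_def)
  \<comment> \<open>The glued face is split off, since its weight needs separate treatment.\<close>
  have "faces K i = insert ?Z (image h1 ` ?S1 \<union> image h2 ` ?S2)"
  proof -
    have "image h1 ` faces K1 i = insert ?Z (image h1 ` ?S1)"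
      by (subst insert_Diff[OF mem(1), symmetric]) (rule image_insert)
    moreover have "image h2 ` faces K2 i = insert ?Z (image h2 ` ?S2)"
      by (subst insert_Diff[OF mem(2), symmetric]) (simp only: image_insert image_us_eq)
    ultimately show ?thesis
      unfolding faces_K_eq by simp
  qed
  moreover have "?Z \<notin> image h1 ` ?S1 \<union> image h2 ` ?S2"
  proof -
    have "?Z \<notin> image h1 ` ?S1"
      by (simp add: image_iff inj_image_eq_iff[OF inj1])
    moreover have "?Z \<notin> image h2 ` ?S2"
      unfolding image_us_eq[symmetric] by (simp add: image_iff inj_image_eq_iff[OF inj2])
    ultimately show ?thesis
      by simp
  qed
  moreover have "image h1 ` ?S1 \<inter> image h2 ` ?S2 = {}"
    using faces_disjoint[of i] by fastforce
  moreover have "f (some_orientation ?Z) * g (some_orientation ?Z) = t"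
    using some_orientation_prod[OF assms(2,3), of "map h1 vs"] set_vs(4)
      inj_on_subset[OF inj1 subset_UNIV]
    by (simp add: t_def distinct_map)
  ultimately have "cochain_inner K (normalized_weight K) i f g = normalized_weight K ?Z * t +
      ((\<Sum>F\<in>?S1. normalized_weight K1 F * pullback K1 i h1 f (some_orientation F) * pullback K1 i h1 g (some_orientation F)) +
       (\<Sum>F\<in>?S2. normalized_weight K2 F * pullback K2 i h2 f (some_orientation F) * pullback K2 i h2 g (some_orientation F)))"
    unfolding cochain_inner_def
    using finite inner_image_h1[OF assms(2,3), of ?S1] flip.inner_image_h1[OF assms(2,3), of ?S2]
    by (simp add: sum.union_disjoint mult.assoc)
  moreover have "cochain_inner K1 (normalized_weight K1) i (pullback K1 i h1 f) (pullback K1 i h1 g) =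
      normalized_weight K1 (set vs) * t +
      (\<Sum>F\<in>?S1. normalized_weight K1 F * pullback K1 i h1 f (some_orientation F) * pullback K1 i h1 g (some_orientation F))"
    unfolding cochain_inner_def sum.remove[OF finite(1) mem(1)]
    using some_orientation_prod[OF pullback_in_cochains[OF assms(2), of K1 h1]
        pullback_in_cochains[OF assms(3), of K1 h1] set_vs(4)] vs
    by (simp add: pullback_oriented t_def mult.assoc)
  moreover have "cochain_inner K2 (normalized_weight K2) i (pullback K2 i h2 f) (pullback K2 i h2 g) =
      normalized_weight K2 (set us) * t +
      (\<Sum>F\<in>?S2. normalized_weight K2 F * pullback K2 i h2 f (some_orientation F) * pullback K2 i h2 g (some_orientation F))"
    unfolding cochain_inner_def sum.remove[OF finite(2) mem(2)]
    using some_orientation_prod[OF pullback_in_cochains[OF assms(2), of K2 h2]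
        pullback_in_cochains[OF assms(3), of K2 h2] flip.set_vs(4)] us
    by (simp add: pullback_oriented t_def glue mult.assoc)
  ultimately show ?thesis
    by (simp add: algebra_simps)
qed

text \<open>Take \<open>f1\<close> on the faces coming from \<open>K1\<close> and \<open>f2\<close>
  on the rest. A conflict can only arise on the glued face, where agreement at one ordering implies
  agreement at all.\<close>

lemma ex_glued_cochain:
  assumes "f1 \<in> cochains K1 i" "f2 \<in> cochains K2 i" "f1 (oriented vs) = f2 (oriented us)"
  obtains f where "f \<in> cochains K i" "pullback K1 i h1 f = f1" "pullback K2 i h2 f = f2"
proof -
  interpret flip: face_gluing h2 h1 K2 K1 us vs i K
    by (rule flip)
  \<comment> \<open>On lists that are not ordered faces of \<open>K\<close> the formula has no
    meaning; \<open>cochain_of\<close> sets those values to 0.\<close>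
  define \<phi> where "\<phi> = (\<lambda>l. if set l \<in> image h1 ` K1
    then f1 (oriented (map (inv h1) l)) else f2 (oriented (map (inv h2) l)))"
  have alt: "alternating \<phi>"
    unfolding \<phi>_def
    by (rule alternating_if_set[where P = "\<lambda>A. A \<in> image h1 ` K1"])
       (intro alternating_map[of "\<lambda>l. f1 (oriented l)"] alternating_map[of "\<lambda>l. f2 (oriented l)"]
          cochains_alternating[OF assms(1)] cochains_alternating[OF assms(2)])+
  let ?f = "cochain_of K i \<phi>"
  have f: "?f \<in> cochains K i"
    by (rule cochain_of_in_cochains[OF alt])
  have f_oriented: "?f (oriented l) = \<phi> l" if "l \<in> ordered_faces K i" for l
    using that by (simp add: cochain_of_oriented[OF alt])
  have on1: "?f (oriented (map h1 ws)) = f1 (oriented ws)" if ws: "ws \<in> ordered_faces K1 i" for ws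
  proof -
    have "h1 ` set ws \<in> image h1 ` K1"
      using ws by (auto simp: ordered_faces_def faces_def)
    then have "\<phi> (map h1 ws) = f1 (oriented ws)"
      by (simp add: \<phi>_def inv_f_f[OF inj1] o_def)
    then show ?thesis
      using f_oriented[OF ordered_faces_map[OF inj1 image_h1_in_K ws]] by simp
  qed
  have on2: "?f (oriented (map h2 ws)) = f2 (oriented ws)" if ws: "ws \<in> ordered_faces K2 i" for ws
  proof (cases "h2 ` set ws \<in> image h1 ` K1")
    \<comment> \<open>Among the \<open>i\<close>-faces of \<open>K2\<close> only the glued one also
      comes from \<open>K1\<close>, and there the value was taken from \<open>f1\<close>.\<close>
    case True
    then have "h2 ` set ws \<subseteq> range h1"
      by auto
    then have "set us = set ws"
      using flip.eq_set_vs[of "set ws"] ws by (simp add: ordered_faces_def faces_def)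
    show ?thesis
    proof (rule alternating_eqI[of "\<lambda>l. ?f (oriented (map h2 l))" "\<lambda>l. f2 (oriented l)" us ws])
      show "alternating (\<lambda>l. ?f (oriented (map h2 l)))"
        by (rule alternating_map[of "\<lambda>l. ?f (oriented l)"]) (rule cochains_alternating[OF f])
      show "alternating (\<lambda>l. f2 (oriented l))"
        by (rule cochains_alternating[OF assms(2)])
      show "?f (oriented (map h2 us)) = f2 (oriented us)"
        using on1[OF vs] assms(3) by (simp add: glue)
    qed (use \<open>set us = set ws\<close> flip.set_vs ws in \<open>auto simp: ordered_faces_def\<close>)
  next
    case False
    then have "\<phi> (map h2 ws) = f2 (oriented ws)"
      by (simp add: \<phi>_def inv_f_f[OF inj2] o_def)
    then show ?thesis
      using f_oriented[OF ordered_faces_map[OF inj2 flip.image_h1_in_K ws]] by simp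
  qed
  show thesis
  proof (rule that[OF f])
    show "pullback K1 i h1 ?f = f1"
      by (rule cochains_eqI[OF pullback_in_cochains[OF f] assms(1)]) (simp add: pullback_oriented on1)
    show "pullback K2 i h2 ?f = f2"
      by (rule cochains_eqI[OF pullback_in_cochains[OF f] assms(2)]) (simp add: pullback_oriented on2)
  qed
qed

lemma eigenvalue_glued:
  assumes f1: "eigenfunction K1 i lam f1" and f2: "eigenfunction K2 i lam f2"
    and eq: "f1 (oriented vs) = f2 (oriented us)"
  shows "lam \<in> up_spectrum K i"
proof -
  interpret flip: face_gluing h2 h1 K2 K1 us vs i K
    by (rule flip)
  obtain f where f: "f \<in> cochains K i" and pull: "pullback K1 i h1 f = f1" "pullback K2 i h2 f = f2"
    using ex_glued_cochain f1 f2 eq unfolding eigenfunction_def by metis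
  have "f \<noteq> (\<lambda>_. 0)"
  proof
    assume "f = (\<lambda>_. 0)"
    then have "f1 = (\<lambda>_. 0)"
      unfolding pull(1)[symmetric] by (simp add: pullback_def fun_eq_iff)
    then show False
      using f1 by (simp add: eigenfunction_def)
  qed
  have f_glued: "f (oriented (map h1 vs)) = f1 (oriented vs)"
    using vs by (simp add: pull(1)[symmetric] pullback_oriented)
  \<comment> \<open>If the glued face is a facet on either side, the eigenvalue equation of that
    side makes the product vanish; \<open>eq\<close> carries this from \<open>f2\<close> to
    \<open>f1\<close>.\<close>
  have weights: "normalized_weight K (h1 ` set vs) =
      normalized_weight K1 (set vs) + normalized_weight K2 (set us) \<or> lam * f1 (oriented vs) = 0"
    using normalized_weight_glued_face eigenfunction_zero_on_facet[OF complex1 f1 vs]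
      eigenfunction_zero_on_facet[OF complex2 f2 us] eq by auto
  have "cochain_inner K (normalized_weight K) (Suc i) (coboundary K i g) (coboundary K i f) =
      lam * cochain_inner K (normalized_weight K) i g f" if g: "g \<in> cochains K i" for g
  proof -
    let ?t = "g (oriented (map h1 vs)) * f (oriented (map h1 vs))"
    have "cochain_inner K (normalized_weight K) (Suc i) (coboundary K i g) (coboundary K i f) =
        cochain_inner K1 (normalized_weight K1) (Suc i) (coboundary K1 i (pullback K1 i h1 g)) (coboundary K1 i f1) +
        cochain_inner K2 (normalized_weight K2) (Suc i) (coboundary K2 i (pullback K2 i h2 g)) (coboundary K2 i f2)"
      unfolding cochain_inner_glued_Suc[OF coboundary_in_cochains[OF g] coboundary_in_cochains[OF f]]
      by (simp only: pull coboundary_pullback[OF complex1 inj1 image_h1_in_K, symmetric] f g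
          coboundary_pullback[OF complex2 inj2 flip.image_h1_in_K, symmetric])
    also have "\<dots> = lam * cochain_inner K1 (normalized_weight K1) i (pullback K1 i h1 g) f1 +
        lam * cochain_inner K2 (normalized_weight K2) i (pullback K2 i h2 g) f2"
      using f1 f2 pullback_in_cochains[OF g, of K1 h1] pullback_in_cochains[OF g, of K2 h2]
      unfolding eigenfunction_iff_weak[OF complex1] eigenfunction_iff_weak[OF complex2] by simp
    also have "\<dots> = lam * (cochain_inner K (normalized_weight K) i g f +
        (normalized_weight K1 (set vs) + normalized_weight K2 (set us)) * ?t -
        normalized_weight K (h1 ` set vs) * ?t)"
      unfolding cochain_inner_glued[OF g f] pull by (simp add: algebra_simps)
    \<comment> \<open>The surplus is a difference of weights times \<open>lam * ?t\<close>: either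
      the weights cancel, or \<open>lam * f1 (oriented vs)\<close> is a vanishing factor.\<close>
    also have "\<dots> = lam * cochain_inner K (normalized_weight K) i g f"
      using weights by (auto simp: f_glued algebra_simps)
    finally show ?thesis .
  qed
  with f \<open>f \<noteq> (\<lambda>_. 0)\<close> have "eigenfunction K i lam f"
    unfolding eigenfunction_iff_weak[OF finite_complex_K] by blast
  then show ?thesis
    unfolding up_spectrum_def by blast
qed

end

section \<open>The wedge sum as a gluing along a face\<close>

theorem theorem6p3:
  fixes K1 :: "'a set set" and K2 :: "'b set set" and i :: nat and lam :: real
    and f1 :: "'a list set \<Rightarrow> real" and f2 :: "'b list set \<Rightarrow> real"
    and vs :: "'a list" and us :: "'b list"
  assumes "finite_complex K1" and "finite_complex K2"
    and "lam \<in> up_spectrum K1 i" and "lam \<in> up_spectrum K2 i"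
    and "eigenfunction K1 i lam f1" and "eigenfunction K2 i lam f2"
    and "vs \<in> ordered_faces K1 i" and "us \<in> ordered_faces K2 i"
    and "f1 (oriented vs) = f2 (oriented us)"
  shows "lam \<in> up_spectrum (wedge_sum vs us K1 K2) i"
proof -
  let ?h1 = "\<lambda>v. wedge_rel vs us `` {Inl v}" and ?h2 = "\<lambda>u. wedge_rel vs us `` {Inr u}"
  have distinct: "distinct vs" "distinct us"
    using assms(7,8) by (auto simp: ordered_faces_def)
  have length: "length vs = length us"
    using assms(7,8) distinct by (simp add: ordered_faces_def faces_def distinct_card)
  have equiv: "equiv UNIV (wedge_rel vs us)"
    by (rule equiv_wedge_rel[OF distinct length])
  \<comment> \<open>Equality of vertices of the wedge becomes membership in the relation, which
    settles the conditions on the vertex maps.\<close>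
  have class_eq: "wedge_rel vs us `` {x} = wedge_rel vs us `` {y} \<longleftrightarrow> (x, y) \<in> wedge_rel vs us" for x y
    using eq_equiv_class_iff[OF equiv] by simp
  have "face_gluing ?h1 ?h2 K1 K2 vs us i (wedge_sum vs us K1 K2)"
  proof
    show "inj ?h1" "inj ?h2"
      by (auto simp: inj_def class_eq wedge_rel_def)
    have "(vs ! k, us ! k) \<in> set (zip vs us)" if "k < length vs" for k
      using that length by (auto simp: in_set_zip)
    then have "?h1 (vs ! k) = ?h2 (us ! k)" if "k < length vs" for k
      unfolding class_eq using that by (auto simp: wedge_rel_def)
    then show "map ?h1 vs = map ?h2 us"
      using length by (intro nth_equalityI) simp_all
    \<comment> \<open>A class in both ranges relates some \<open>Inl v\<close> to some
      \<open>Inr u\<close>, which happens only for zipped pairs, so \<open>v\<close> lies in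
      \<open>vs\<close>.\<close>
    show "range ?h1 \<inter> range ?h2 \<subseteq> ?h1 ` set vs"
      by (auto simp: class_eq wedge_rel_def dest: set_zip_leftD)
  qed (use assms in \<open>simp_all add: wedge_sum_def\<close>)
  then show ?thesis
    using assms by (intro face_gluing.eigenvalue_glued)
qed

end
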